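(* Let $\alpha\ne1$ and let $\{p_\theta:\theta\in\Theta\}$ be a regular $\mathbb{B}^{(\alpha)}$-family characterized by $h,w,f,\Theta,\mathbb{S}$ with normalizing function $F$, i.e. $p_\theta(\mathbf{x})=[h+F(\theta)+w(\theta)^\top f(\mathbf{x})]^{1/(\alpha-1)}$ on $\mathbb{S}$, where $h$ is a non-zero constant, $w=[w_1,\dots,w_k]^\top$ and $f=[f_1,\dots,f_k]^\top$. Suppose that $1+F(\theta)/h>0$ for all $\theta\in\Theta$ and that one of the following conditions holds: (a) $F(\theta)$ is identically a constant; or (b) the functions $1,F,w_1,\dots,w_k$ are linearly independent on $\Theta$. Then $\{p_\theta:\theta\in\Theta\}$ also forms a regular $\mathbb{M}^{(\alpha)}$-family characterized by the same functions $h$ and $f_1,\dots,f_k$.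
   Context: $\mathbb{B}^{(\alpha)}$-family: a family of probability distributions $\{p_\theta:\theta\in\Theta\}$ on $\mathbb{R}^d$, $\Theta\subset\mathbb{R}^k$ open, with $\mathbb{S}$ the support of $p_\theta$, is a $k$-parameter $\mathbb{B}^{(\alpha)}$-family characterized by $h,w,f,\Theta,\mathbb{S}$ (where $w=[w_1,\dots,w_s]^\top$, $w_i:\Theta\to\mathbb{R}$ differentiable, $f=[f_1,\dots,f_s]^\top$, $f_i:\mathbb{R}^d\to\mathbb{R}$, $h:\mathbb{R}^d\to\mathbb{R}$) if $p_\theta(\mathbf{x})=[h(\mathbf{x})+F(\theta)+w(\theta)^\top f(\mathbf{x})]^{1/(\alpha-1)}$ for $\mathbf{x}\in\mathbb{S}$ and $p_\theta(\mathbf{x})=0$ otherwise, for some differentiable $F:\Theta\to\mathbb{R}$. It is regular if (i) $\mathbb{S}$ does not depend on $\theta$; (ii) $s=k$; (iii) $1,w_1,\dots,w_s$ are linearly independent on $\Theta$; (iv) $1,f_1,\dots,f_s$ are linearly independent on $\mathbb{S}$. $\mathbb{M}^{(\alpha)}$-family: with $h,w,f,\Theta,\mathbb{S}$ of the same kind, the family is an $\mathbb{M}^{(\alpha)}$-family characterized by $h,w,f,\Theta,\mathbb{S}$ if $p_\theta(\mathbf{x})=Z(\theta)[h(\mathbf{x})+w(\theta)^\top f(\mathbf{x})]^{1/(\alpha-1)}$ for $\mathbf{x}\in\mathbb{S}$ and $0$ otherwise, for some differentiable $Z:\Theta\to\mathbb{R}$. It is regular if (i)–(iii) above hold and $f_1,\dots,f_s$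 are linearly independent on $\mathbb{S}$. In the conclusion, the functions $w_i$ characterizing the $\mathbb{M}^{(\alpha)}$-family need not be those of the $\mathbb{B}^{(\alpha)}$-family. *)

theory Defs
  imports "HOL-Analysis.Analysis" "HOL-Probability.Probability"
begin

definition lin_indep_on :: "('i::finite \<Rightarrow> 'a \<Rightarrow> real) \<Rightarrow> 'a set \<Rightarrow> bool" where
  "lin_indep_on g A \<longleftrightarrow>
     (\<forall>c. (\<forall>x\<in>A. (\<Sum>i\<in>UNIV. c i * g i x) = 0) \<longrightarrow> (\<forall>i. c i = 0))"

(* The finite system g with one more function u; the index type grows by None. *)
definition adjoin :: "('a \<Rightarrow> real) \<Rightarrow> ('i \<Rightarrow> 'a \<Rightarrow> real) \<Rightarrow> 'i option \<Rightarrow> 'a \<Rightarrow> real" where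
  "adjoin u g = case_option u g"

definition comps :: "('a \<Rightarrow> real ^ 'i) \<Rightarrow> 'i \<Rightarrow> 'a \<Rightarrow> real" where
  "comps v i x = v x $ i"

(* The distributions are given by their densities p \<theta> with respect to a common reference measure \<mu>
   on the Borel sets, so that Lebesgue densities and probability mass functions are both covered.
   S \<theta> is the support of p \<theta>, in the sense of the set where the density is positive. *)
definition density_family ::
  "(real ^ 'd) measure \<Rightarrow> (real ^ 'k \<Rightarrow> real ^ 'd \<Rightarrow> real) \<Rightarrow> (real ^ 'k) set \<Rightarrow>
   (real ^ 'k \<Rightarrow> (real ^ 'd) set) \<Rightarrow> bool" where
  "density_family \<mu> p \<Theta> S \<longleftrightarrow>
     sets \<mu> = sets borel \<and> open \<Theta> \<and>
     (\<forall>\<theta>\<in>\<Theta>. p \<theta> \<in> borel_measurable \<mu> \<and> (\<forall>x. 0 \<le> p \<theta> x) \<and>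
        prob_space (density \<mu> (\<lambda>x. ennreal (p \<theta> x))) \<and>
        S \<theta> = {x. 0 < p \<theta> x})"

(* The base of the real power is required to be positive on the support: powr takes unintended
   values at negative bases. *)
definition B_family_with ::
  "real \<Rightarrow> (real ^ 'd) measure \<Rightarrow> (real ^ 'k \<Rightarrow> real ^ 'd \<Rightarrow> real) \<Rightarrow> (real ^ 'k \<Rightarrow> real) \<Rightarrow>
   (real ^ 'd \<Rightarrow> real) \<Rightarrow> (real ^ 'k \<Rightarrow> real ^ 's) \<Rightarrow> (real ^ 'd \<Rightarrow> real ^ 's) \<Rightarrow>
   (real ^ 'k) set \<Rightarrow> (real ^ 'k \<Rightarrow> (real ^ 'd) set) \<Rightarrow> bool" where
  "B_family_with \<alpha> \<mu> p F h w f \<Theta> S \<longleftrightarrow>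
     density_family \<mu> p \<Theta> S \<and>
     (\<forall>i. comps w i differentiable_on \<Theta>) \<and> F differentiable_on \<Theta> \<and>
     (\<forall>\<theta>\<in>\<Theta>. \<forall>x\<in>S \<theta>. 0 < h x + F \<theta> + w \<theta> \<bullet> f x \<and>
        p \<theta> x = (h x + F \<theta> + w \<theta> \<bullet> f x) powr (1 / (\<alpha> - 1))) \<and>
     (\<forall>\<theta>\<in>\<Theta>. \<forall>x. x \<notin> S \<theta> \<longrightarrow> p \<theta> x = 0)"

definition B_family ::
  "real \<Rightarrow> (real ^ 'd) measure \<Rightarrow> (real ^ 'k \<Rightarrow> real ^ 'd \<Rightarrow> real) \<Rightarrow>
   (real ^ 'd \<Rightarrow> real) \<Rightarrow> (real ^ 'k \<Rightarrow> real ^ 's) \<Rightarrow> (real ^ 'd \<Rightarrow> real ^ 's) \<Rightarrow>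
   (real ^ 'k) set \<Rightarrow> (real ^ 'k \<Rightarrow> (real ^ 'd) set) \<Rightarrow> bool" where
  "B_family \<alpha> \<mu> p h w f \<Theta> S \<longleftrightarrow> (\<exists>F. B_family_with \<alpha> \<mu> p F h w f \<Theta> S)"

definition regular_B_family ::
  "real \<Rightarrow> (real ^ 'd) measure \<Rightarrow> (real ^ 'k \<Rightarrow> real ^ 'd \<Rightarrow> real) \<Rightarrow>
   (real ^ 'd \<Rightarrow> real) \<Rightarrow> (real ^ 'k \<Rightarrow> real ^ 's) \<Rightarrow> (real ^ 'd \<Rightarrow> real ^ 's) \<Rightarrow>
   (real ^ 'k) set \<Rightarrow> (real ^ 'k \<Rightarrow> (real ^ 'd) set) \<Rightarrow> bool" where
  "regular_B_family \<alpha> \<mu> p h w f \<Theta> S \<longleftrightarrow>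
     B_family \<alpha> \<mu> p h w f \<Theta> S \<and>
     (\<forall>\<theta>\<in>\<Theta>. \<forall>\<theta>'\<in>\<Theta>. S \<theta> = S \<theta>') \<and>
     CARD('s) = CARD('k) \<and>
     lin_indep_on (adjoin (\<lambda>_. 1) (comps w)) \<Theta> \<and>
     (\<forall>\<theta>\<in>\<Theta>. lin_indep_on (adjoin (\<lambda>_. 1) (comps f)) (S \<theta>))"

definition M_family ::
  "real \<Rightarrow> (real ^ 'd) measure \<Rightarrow> (real ^ 'k \<Rightarrow> real ^ 'd \<Rightarrow> real) \<Rightarrow>
   (real ^ 'd \<Rightarrow> real) \<Rightarrow> (real ^ 'k \<Rightarrow> real ^ 's) \<Rightarrow> (real ^ 'd \<Rightarrow> real ^ 's) \<Rightarrow>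
   (real ^ 'k) set \<Rightarrow> (real ^ 'k \<Rightarrow> (real ^ 'd) set) \<Rightarrow> bool" where
  "M_family \<alpha> \<mu> p h w f \<Theta> S \<longleftrightarrow>
     density_family \<mu> p \<Theta> S \<and>
     (\<forall>i. comps w i differentiable_on \<Theta>) \<and>
     (\<exists>Z. Z differentiable_on \<Theta> \<and>
       (\<forall>\<theta>\<in>\<Theta>. \<forall>x\<in>S \<theta>. 0 < h x + w \<theta> \<bullet> f x \<and>
          p \<theta> x = Z \<theta> * (h x + w \<theta> \<bullet> f x) powr (1 / (\<alpha> - 1))) \<and>
       (\<forall>\<theta>\<in>\<Theta>. \<forall>x. x \<notin> S \<theta> \<longrightarrow> p \<theta> x = 0))"

definition regular_M_family ::
  "real \<Rightarrow> (real ^ 'd) measure \<Rightarrow> (real ^ 'k \<Rightarrow> real ^ 'd \<Rightarrow> real) \<Rightarrow>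
   (real ^ 'd \<Rightarrow> real) \<Rightarrow> (real ^ 'k \<Rightarrow> real ^ 's) \<Rightarrow> (real ^ 'd \<Rightarrow> real ^ 's) \<Rightarrow>
   (real ^ 'k) set \<Rightarrow> (real ^ 'k \<Rightarrow> (real ^ 'd) set) \<Rightarrow> bool" where
  "regular_M_family \<alpha> \<mu> p h w f \<Theta> S \<longleftrightarrow>
     M_family \<alpha> \<mu> p h w f \<Theta> S \<and>
     (\<forall>\<theta>\<in>\<Theta>. \<forall>\<theta>'\<in>\<Theta>. S \<theta> = S \<theta>') \<and>
     CARD('s) = CARD('k) \<and>
     lin_indep_on (adjoin (\<lambda>_. 1) (comps w)) \<Theta> \<and>
     (\<forall>\<theta>\<in>\<Theta>. lin_indep_on (comps f) (S \<theta>))"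

end

theory Submission
  imports Defs
begin

text \<open>
  Put \<open>a \<theta> = 1 + F \<theta> / c\<close>. Since \<open>c + F \<theta> = c * a \<theta>\<close>, the factor \<open>a \<theta>\<close> can be pulled out of the bracket, with
  \<open>w' = w / a\<close> and \<open>Z = a powr (1 / (\<alpha> - 1))\<close>. Multiplying by \<open>a\<close> turns a linear relation between
  \<open>1\<close> and the \<open>w' i\<close> into one between \<open>1\<close>, \<open>F\<close> and the \<open>w i\<close>.
\<close>

lemma sum_adjoin:
  fixes g :: "'i::finite \<Rightarrow> 'a \<Rightarrow> real"
  shows "(\<Sum>j\<in>UNIV. b j * adjoin u g j x) = b None * u x + (\<Sum>i\<in>UNIV. b (Some i) * g i x)"
  by (simp add: UNIV_option_conv sum.reindex adjoin_def)

text \<open>Coefficients indexed by an option type amount to a pair: one for the adjoined function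
  and a family for the others. In this form, relations can be rescaled and compared without handling
  \<open>None\<close> and \<open>Some\<close> explicitly.\<close>

lemma lin_indep_on_adjoin:
  fixes g :: "'i::finite \<Rightarrow> 'a \<Rightarrow> real"
  shows "lin_indep_on (adjoin u g) A \<longleftrightarrow>
    (\<forall>b0 b. (\<forall>x\<in>A. b0 * u x + (\<Sum>i\<in>UNIV. b i * g i x) = 0) \<longrightarrow> b0 = 0 \<and> (\<forall>i. b i = 0))"
proof
  assume L: "lin_indep_on (adjoin u g) A"
  show "\<forall>b0 b. (\<forall>x\<in>A. b0 * u x + (\<Sum>i\<in>UNIV. b i * g i x) = 0) \<longrightarrow> b0 = 0 \<and> (\<forall>i. b i = 0)"
  proof (intro allI impI)
    fix b0 :: real and b :: "'i \<Rightarrow> real"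
    assume "\<forall>x\<in>A. b0 * u x + (\<Sum>i\<in>UNIV. b i * g i x) = 0"
    then have "\<forall>j. case_option b0 b j = 0"
      using L[unfolded lin_indep_on_def, rule_format, of "case_option b0 b"]
      by (simp add: sum_adjoin)
    then show "b0 = 0 \<and> (\<forall>i. b i = 0)"
      by (metis option.case)
  qed
next
  assume R: "\<forall>b0 b. (\<forall>x\<in>A. b0 * u x + (\<Sum>i\<in>UNIV. b i * g i x) = 0) \<longrightarrow> b0 = 0 \<and> (\<forall>i. b i = 0)"
  show "lin_indep_on (adjoin u g) A"
    unfolding lin_indep_on_def sum_adjoin
  proof (intro allI impI)
    fix b :: "'i option \<Rightarrow> real" and j
    assume "\<forall>x\<in>A. b None * u x + (\<Sum>i\<in>UNIV. b (Some i) * g i x) = 0"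
    then have "b None = 0 \<and> (\<forall>i. b (Some i) = 0)"
      using R[rule_format, of "b None" "\<lambda>i. b (Some i)"] by blast
    then show "b j = 0"
      by (cases j) auto
  qed
qed

text \<open>A relation among the \<open>g i\<close> extends to \<open>u\<close> with coefficient 0.
  This bridges the two notions of regularity: for the first kind of family the \<open>f\<close> are
  independent together with 1, for the second only among themselves.\<close>

lemma lin_indep_on_adjoinD:
  fixes g :: "'i::finite \<Rightarrow> 'a \<Rightarrow> real"
  assumes "lin_indep_on (adjoin u g) A"
  shows "lin_indep_on g A"
  unfolding lin_indep_on_def
proof (intro allI impI)
  fix b i assume "\<forall>x\<in>A. (\<Sum>i\<in>UNIV. b i * g i x) = 0"
  then show "b i = 0"
    using assms[unfolded lin_indep_on_adjoin, rule_format, of 0 b] by simp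
qed

text \<open>The chain rule applies because positivity keeps the base away from 0. It serves the
  normalizing factor Z.\<close>

lemma differentiable_on_powr_const:
  fixes g :: "'a::real_normed_vector \<Rightarrow> real"
  assumes "g differentiable_on A" and "\<And>x. x \<in> A \<Longrightarrow> 0 < g x"
  shows "(\<lambda>x. g x powr r) differentiable_on A"
  unfolding differentiable_on_def
proof
  fix x assume x: "x \<in> A"
  then obtain g' where "(g has_derivative g') (at x within A)"
    using assms(1) by (auto simp: differentiable_on_def differentiable_def)
  from has_derivative_powr[OF this has_derivative_const assms(2)[OF x] x]
  show "(\<lambda>x. g x powr r) differentiable at x within A"
    unfolding differentiable_def by blast
qed

text \<open>Clearing the common denominator leaves \<open>b0 + (b0 / c) * F x\<close> plus the
  combination of the \<open>g i\<close>. If \<open>F\<close> is a constant K, the first part is the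
  constant \<open>b0 * (1 + K / c)\<close>, so independence of 1 and the \<open>g i\<close>
  suffices. Otherwise independence of 1, \<open>F\<close> and the \<open>g i\<close> applies
  directly.\<close>

lemma lin_indep_on_adjoin_one_divide:
  fixes g :: "'i::finite \<Rightarrow> 'a \<Rightarrow> real"
  assumes one: "lin_indep_on (adjoin (\<lambda>_. 1) g) A"
    and pos: "\<And>x. x \<in> A \<Longrightarrow> 1 + F x / c > 0"
    and F: "F constant_on A \<or> lin_indep_on (adjoin (\<lambda>_. 1) (adjoin F g)) A"
  shows "lin_indep_on (adjoin (\<lambda>_. 1) (\<lambda>i x. g i x / (1 + F x / c))) A"
  unfolding lin_indep_on_adjoin
proof (intro allI impI)
  fix b0 b
  assume rel: "\<forall>x\<in>A. b0 * 1 + (\<Sum>i\<in>UNIV. b i * (g i x / (1 + F x / c))) = 0"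
  have eq: "b0 * (1 + F x / c) + (\<Sum>i\<in>UNIV. b i * g i x) = 0" if x: "x \<in> A" for x
  proof -
    have "0 = (b0 + (\<Sum>i\<in>UNIV. b i * (g i x / (1 + F x / c)))) * (1 + F x / c)"
      using rel x by simp
    also have "\<dots> = b0 * (1 + F x / c) + (\<Sum>i\<in>UNIV. b i * g i x)"
      using pos[OF x] by (simp add: distrib_right[of _ _ "1 + F x / c"] sum_distrib_right)
    finally show ?thesis by simp
  qed
  from F show "b0 = 0 \<and> (\<forall>i. b i = 0)"
  proof
    assume "F constant_on A"
    then obtain K where K: "\<And>x. x \<in> A \<Longrightarrow> F x = K"
      by (auto simp: constant_on_def)
    have "b0 * (1 + K / c) = 0 \<and> (\<forall>i. b i = 0)"
      using one[unfolded lin_indep_on_adjoin, rule_format, of "b0 * (1 + K / c)" b] eq K by simp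
    \<comment> \<open>On the empty set the coefficients 1, 0, ..., 0 would give a vanishing
      relation. A point of \<open>A\<close> is needed to turn the pointwise positivity into
      positivity of the number \<open>1 + K / c\<close>, which can then be cancelled.\<close>
    moreover have "A \<noteq> {}"
      using one[unfolded lin_indep_on_adjoin, rule_format, of 1 "\<lambda>_. 0"] by auto
    then have "1 + K / c > 0"
      using K pos by (metis ex_in_conv)
    ultimately show ?thesis by auto
  next
    assume L: "lin_indep_on (adjoin (\<lambda>_. 1) (adjoin F g)) A"
    \<comment> \<open>The inner system carries \<open>F\<close> with coefficient
      \<open>b0 / c\<close> and the \<open>g i\<close> with \<open>b i\<close>; the outer constant
      function carries \<open>b0\<close>.\<close>
    have "(\<Sum>j\<in>UNIV. case_option (b0 / c) b j * adjoin F g j x) =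
      b0 / c * F x + (\<Sum>i\<in>UNIV. b i * g i x)" for x
      by (simp add: sum_adjoin)
    then have "b0 = 0 \<and> (\<forall>j. case_option (b0 / c) b j = 0)"
      using L[unfolded lin_indep_on_adjoin[where g = "adjoin F g"], rule_format,
          of b0 "case_option (b0 / c) b"] eq
      by (simp add: algebra_simps)
    then show ?thesis
      by (metis option.case(2))
  qed
qed

theorem proposition4:
  fixes \<alpha> c :: real
    and \<mu> :: "(real ^ 'd) measure"
    and p :: "real ^ 'k \<Rightarrow> real ^ 'd \<Rightarrow> real"
    and F :: "real ^ 'k \<Rightarrow> real"
    and h :: "real ^ 'd \<Rightarrow> real"
    and w :: "real ^ 'k \<Rightarrow> real ^ 's"
    and f :: "real ^ 'd \<Rightarrow> real ^ 's"
    and \<Theta> :: "(real ^ 'k) set"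
    and S :: "real ^ 'k \<Rightarrow> (real ^ 'd) set"
  assumes "\<alpha> \<noteq> 1"
    and "regular_B_family \<alpha> \<mu> p h w f \<Theta> S"
    and "B_family_with \<alpha> \<mu> p F h w f \<Theta> S"
    and "h = (\<lambda>_. c)" and "c \<noteq> 0"
    and "\<forall>\<theta>\<in>\<Theta>. 1 + F \<theta> / c > 0"
    and "F constant_on \<Theta> \<or>
         lin_indep_on (adjoin (\<lambda>_. 1) (adjoin F (comps w))) \<Theta>"
  shows "\<exists>w' :: real ^ 'k \<Rightarrow> real ^ 's. regular_M_family \<alpha> \<mu> p h w' f \<Theta> S"
proof -
  define a where "a = (\<lambda>\<theta>. 1 + F \<theta> / c)"
  define w' where "w' = (\<lambda>\<theta>. (1 / a \<theta>) *\<^sub>R w \<theta>)"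
  note B = assms(3)[unfolded B_family_with_def]
  note R = assms(2)[unfolded regular_B_family_def]
  have a: "0 < a \<theta>" if "\<theta> \<in> \<Theta>" for \<theta>
    using assms(6) that by (simp add: a_def)
  have comps_w': "comps w' = (\<lambda>i \<theta>. comps w i \<theta> / a \<theta>)"
    by (simp add: comps_def w'_def fun_eq_iff)
  have a_diff: "a differentiable_on \<Theta>"
    unfolding a_def using B
    by (auto simp: divide_inverse intro!: differentiable_on_add differentiable_on_mult)
  have w'_diff: "comps w' i differentiable_on \<Theta>" for i
    unfolding comps_w' using a a_diff B
    by (fastforce simp: differentiable_on_def intro!: differentiable_divide)
  have Z_diff: "(\<lambda>\<theta>. a \<theta> powr (1 / (\<alpha> - 1))) differentiable_on \<Theta>"
    using a_diff a by (rule differentiable_on_powr_const)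
  have M: "0 < h x + w' \<theta> \<bullet> f x \<and>
      p \<theta> x = a \<theta> powr (1 / (\<alpha> - 1)) * (h x + w' \<theta> \<bullet> f x) powr (1 / (\<alpha> - 1))"
    if \<theta>: "\<theta> \<in> \<Theta>" and x: "x \<in> S \<theta>" for \<theta> x
  proof -
    have base: "h x + F \<theta> + w \<theta> \<bullet> f x = a \<theta> * (h x + w' \<theta> \<bullet> f x)"
    proof -
      have "a \<theta> * (w' \<theta> \<bullet> f x) = w \<theta> \<bullet> f x"
        using a[OF \<theta>] by (simp add: w'_def)
      \<comment> \<open>Here \<open>h\<close> is the non-zero constant \<open>c\<close>, so that
        \<open>c * (F \<theta> / c)\<close> is \<open>F \<theta>\<close>.\<close>
      moreover have "a \<theta> * h x = h x + F \<theta>"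
        using assms(4,5) by (simp add: a_def field_simps)
      ultimately show ?thesis by (simp add: distrib_left)
    qed
    have "0 < h x + F \<theta> + w \<theta> \<bullet> f x"
      and p: "p \<theta> x = (h x + F \<theta> + w \<theta> \<bullet> f x) powr (1 / (\<alpha> - 1))"
      using B \<theta> x by auto
    \<comment> \<open>The bracket inherits positivity from the product since
      \<open>a \<theta>\<close> is positive. With both factors positive, the real power splits and
      \<open>a \<theta>\<close> moves out as the normalizing factor.\<close>
    then have pos: "0 < h x + w' \<theta> \<bullet> f x"
      using a[OF \<theta>] unfolding base by (simp add: zero_less_mult_iff)
    then show ?thesis
      using p[unfolded base] a[OF \<theta>] by (simp add: powr_mult)
  qed
  have "M_family \<alpha> \<mu> p h w' f \<Theta> S"
    unfolding M_family_def using B w'_diff Z_diff M by blast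
  moreover have "lin_indep_on (adjoin (\<lambda>_. 1) (comps w')) \<Theta>"
    unfolding comps_w' a_def
    using R assms(6,7) by (intro lin_indep_on_adjoin_one_divide) auto
  moreover have "\<forall>\<theta>\<in>\<Theta>. lin_indep_on (comps f) (S \<theta>)"
    using R lin_indep_on_adjoinD by blast
  ultimately have "regular_M_family \<alpha> \<mu> p h w' f \<Theta> S"
    unfolding regular_M_family_def using R by blast
  then show ?thesis by blast
qed

end
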